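(* Let $p\ge 5$ be a prime and let $a$ be a $p$-adic integer such that $\langle a\rangle_p$ is even. Then $$\sum_{k=0}^{p-1}\frac{(-a)_k\,(a+1)_k}{(1)_k}\cdot\frac{(1/2)^k}{k!}\equiv(-1)^{\frac{p+1}{2}}\,\Gamma_p\!\left(\tfrac{1}{2}\right)\Gamma_p\!\left(-\tfrac{a}{2}\right)\Gamma_p\!\left(\tfrac{a+1}{2}\right)\pmod{p^2}.$$ (The left-hand side is the truncated hypergeometric series ${}_2F_1\!\left(-a,\,a+1;\,1;\,\tfrac12\right)_{p-1}$.)
   Context: For a complex (or $p$-adic) number $x$, the Pochhammer symbol is $(x)_0=1$ and $(x)_k=x(x+1)\cdots(x+k-1)$ for $k\ge1$. For a $p$-adic integer $a$, $\langle a\rangle_p$ denotes the least non-negative integer $r$ with $a\equiv r\pmod p$. $\Gamma_p$ is Morita's $p$-adic Gamma function: for $x\in\mathbb{Z}_p$, $\Gamma_p(x)=\lim_{m\to x}(-1)^m\prod_{0<k<m,\ (k,p)=1}k$, the limit taken over non-negative integers $m$ tending to $x$ $p$-adically. Congruences modulo $p^2$ are in $\mathbb{Z}_p$. *)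

theory Defs
  imports Complex_Main "Berlekamp_Zassenhaus.Finite_Field"
begin

text \<open>
  The ring of \<open>p\<close>-adic integers for \<open>p = CARD('p)\<close>, as the inverse limit of the rings
  \<open>\<int>/p\<^sup>n\<int>\<close>: an element is a compatible sequence of least non-negative residues modulo
  \<open>p\<^sup>n\<close>. The defining equation already forces \<open>0 \<le> x n < p\<^sup>n\<close>.
\<close>

typedef 'p padic_int =
  "{x :: nat \<Rightarrow> int. \<forall>n. x (Suc n) mod int CARD('p) ^ n = x n}"
  morphisms residues_of Abs_padic_int
  by (rule exI[of _ "\<lambda>_. 0"]) simp

setup_lifting type_definition_padic_int

lemma residues_of_Suc: "residues_of (x :: 'p padic_int) (Suc n) mod int CARD('p) ^ n = residues_of x n"
  using residues_of[of x] by simp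

lemma residues_of_mod: "residues_of (x :: 'p padic_int) n mod int CARD('p) ^ n = residues_of x n"
  using mod_mod_trivial[of "residues_of x (Suc n)" "int CARD('p) ^ n"]
  unfolding residues_of_Suc .

lemma residues_of_add:
  "residues_of (x :: 'p padic_int) (n + k) mod int CARD('p) ^ n = residues_of x n"
proof (induction k)
  case 0
  show ?case by (simp add: residues_of_mod)
next
  case (Suc k)
  have "residues_of x (n + k) mod int CARD('p) ^ n
      = residues_of x (Suc (n + k)) mod int CARD('p) ^ (n + k) mod int CARD('p) ^ n"
    by (simp add: residues_of_Suc)
  also have "\<dots> = residues_of x (Suc (n + k)) mod int CARD('p) ^ n"
    by (rule mod_mod_cancel) (simp add: power_add)
  finally show ?case using Suc.IH by simp
qed

lemma compatible_aux:
  fixes p :: int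
  assumes "a' mod p ^ n = a mod p ^ n"
  shows "a' mod p ^ Suc n mod p ^ n = a mod p ^ n"
  using assms by (simp add: mod_mod_cancel)

instantiation padic_int :: (prime_card) comm_ring_1
begin

lift_definition zero_padic_int :: "'a padic_int" is "\<lambda>n. 0" by simp

lift_definition one_padic_int :: "'a padic_int" is "\<lambda>n. 1 mod int CARD('a) ^ n"
  by (rule compatible_aux) simp

lift_definition plus_padic_int :: "'a padic_int \<Rightarrow> 'a padic_int \<Rightarrow> 'a padic_int"
  is "\<lambda>x y n. (x n + y n) mod int CARD('a) ^ n"
  by (rule compatible_aux) (metis mod_add_eq)

lift_definition uminus_padic_int :: "'a padic_int \<Rightarrow> 'a padic_int"
  is "\<lambda>x n. (- x n) mod int CARD('a) ^ n"
  by (rule compatible_aux) (metis mod_minus_eq)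

lift_definition minus_padic_int :: "'a padic_int \<Rightarrow> 'a padic_int \<Rightarrow> 'a padic_int"
  is "\<lambda>x y n. (x n - y n) mod int CARD('a) ^ n"
  by (rule compatible_aux) (metis mod_diff_eq)

lift_definition times_padic_int :: "'a padic_int \<Rightarrow> 'a padic_int \<Rightarrow> 'a padic_int"
  is "\<lambda>x y n. (x n * y n) mod int CARD('a) ^ n"
  by (rule compatible_aux) (metis mod_mult_eq)

instance
proof
  fix a b c :: "'a padic_int"
  have res: "x n mod int CARD('a) ^ n = x n" if "\<forall>n. x (Suc n) mod int CARD('a) ^ n = x n"
    for x :: "nat \<Rightarrow> int" and n
    using that[rule_format, of n] mod_mod_trivial[of "x (Suc n)" "int CARD('a) ^ n"] by argo
  show "a * b * c = a * (b * c)"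
    by transfer (simp add: mod_simps mult.assoc)
  show "a * b = b * a"
    by transfer (simp add: mult.commute)
  show "1 * a = a"
    by transfer (simp add: mod_simps res)
  show "a + b + c = a + (b + c)"
    by transfer (simp add: mod_simps add.assoc)
  show "a + b = b + a"
    by transfer (simp add: add.commute)
  show "0 + a = a"
    by transfer (simp add: res)
  show "- a + a = 0"
    by transfer (simp add: mod_simps)
  show "a - b = a + - b"
    by transfer (simp add: mod_simps)
  show "(a + b) * c = a * c + b * c"
    by transfer (simp add: mod_simps distrib_right)
  show "(0 :: 'a padic_int) \<noteq> 1"
  proof (transfer, rule notI)
    assume "(\<lambda>n. 0) = (\<lambda>n. 1 mod int CARD('a) ^ n)"
    from fun_cong[OF this, of 1] show False
      using prime_gt_1_nat[OF prime_card[where ?'a = 'a]] by simp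
  qed
qed

end

lemma residues_of_of_nat:
  "residues_of (of_nat m :: 'p::prime_card padic_int) n = int m mod int CARD('p) ^ n"
proof (induction m)
  case 0
  show ?case by (simp add: zero_padic_int.rep_eq)
next
  case (Suc m)
  then show ?case
    by (simp add: plus_padic_int.rep_eq one_padic_int.rep_eq mod_simps)
qed

lemma padic_int_nonzeroE:
  fixes x :: "'p::prime_card padic_int"
  assumes "x \<noteq> 0"
  obtains n where "residues_of x n \<noteq> 0"
  using assms by (metis ext residues_of_inject zero_padic_int.rep_eq)

lemma residues_of_eq_0_iff:
  "residues_of (x :: 'p padic_int) n = 0 \<longleftrightarrow> int CARD('p) ^ n dvd residues_of x (n + k)"
  by (metis residues_of_add dvd_eq_mod_eq_0)

instance padic_int :: (prime_card) idom
proof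
  fix x y :: "'a padic_int"
  let ?p = "int CARD('a)"
  assume "x \<noteq> 0" "y \<noteq> 0"
  then obtain m n where mn: "residues_of x m \<noteq> 0" "residues_of y n \<noteq> 0"
    by (metis padic_int_nonzeroE)
  define X Y where "X = residues_of x (m + n)" and "Y = residues_of y (m + n)"
  have pr: "prime ?p" using prime_card[where ?'a = 'a] by simp
  have X: "\<not> ?p ^ m dvd X" using mn residues_of_eq_0_iff[of x m n] by (simp add: X_def)
  have Y: "\<not> ?p ^ n dvd Y" using mn residues_of_eq_0_iff[of y n m] by (simp add: Y_def add.commute)
  have nz: "X \<noteq> 0" "Y \<noteq> 0" using X Y by auto
  have nu: "\<not> is_unit ?p" using pr not_prime_unit by blast
  have "multiplicity ?p X < m" "multiplicity ?p Y < n"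
    using X Y nz nu by (simp_all add: power_dvd_iff_le_multiplicity)
  then have "multiplicity ?p (X * Y) < m + n"
    using nz pr by (simp add: prime_elem_multiplicity_mult_distrib prime_imp_prime_elem)
  then have "\<not> ?p ^ (m + n) dvd X * Y"
    using nz nu by (simp add: power_dvd_iff_le_multiplicity)
  then have "residues_of (x * y) (m + n) \<noteq> 0"
    by (simp add: times_padic_int.rep_eq X_def Y_def dvd_eq_mod_eq_0)
  then show "x * y \<noteq> 0" by (auto simp: zero_padic_int.rep_eq)
qed

instance padic_int :: (prime_card) ring_char_0
proof
  show "inj (of_nat :: nat \<Rightarrow> 'a padic_int)"
  proof (rule injI)
    fix m n :: nat
    assume eq: "(of_nat m :: 'a padic_int) = of_nat n"
    define k where "k = max m n"
    have "k < CARD('a) ^ k"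
      using power_gt_expt[of "CARD('a)" k] prime_gt_1_nat[OF prime_card[where ?'a = 'a]] by simp
    then have "int k < int CARD('a) ^ k"
      by (metis of_nat_less_iff of_nat_power)
    then have "int m mod int CARD('a) ^ k = int m" "int n mod int CARD('a) ^ k = int n"
      by (simp_all add: k_def)
    then show "m = n"
      using arg_cong[OF eq, of "\<lambda>x. residues_of x k"] by (simp add: residues_of_of_nat)
  qed
qed

text \<open>
  Exact division: \<open>x div y\<close> is the unique \<open>z\<close> with \<open>z * y = x\<close> whenever \<open>y \<noteq> 0\<close> divides \<open>x\<close>;
  thus it agrees with the quotient in the field of \<open>p\<close>-adic numbers whenever that quotient is a
  \<open>p\<close>-adic integer, in particular whenever \<open>y\<close> is a unit.
\<close>

instantiation padic_int :: (prime_card) idom_divide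
begin

definition divide_padic_int :: "'a padic_int \<Rightarrow> 'a padic_int \<Rightarrow> 'a padic_int" where
  "(x :: 'a padic_int) div y = (if y \<noteq> 0 \<and> y dvd x then THE z. z * y = x else 0)"

instance
  by standard (auto simp: divide_padic_int_def)

end

definition padic_val :: "'p::prime_card padic_int \<Rightarrow> nat" where
  "padic_val x = Max {n. of_nat CARD('p) ^ n dvd x}"

definition padic_abs :: "'p::prime_card padic_int \<Rightarrow> real" where
  "padic_abs x = (if x = 0 then 0 else 1 / real CARD('p) ^ padic_val x)"

lemma finite_padic_val:
  fixes x :: "'p::prime_card padic_int"
  assumes "x \<noteq> 0"
  shows "finite {n. of_nat CARD('p) ^ n dvd x}"
proof -
  obtain N where N: "residues_of x N \<noteq> 0" using assms by (rule padic_int_nonzeroE)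
  have "n < N" if dvd: "of_nat CARD('p) ^ n dvd x" for n
  proof (rule ccontr)
    assume "\<not> n < N"
    then have "of_nat CARD('p) ^ N dvd x" using power_le_dvd[OF dvd] by simp
    then obtain y where "x = of_nat (CARD('p) ^ N) * y" by auto
    then have "residues_of x N = 0"
      by (simp add: times_padic_int.rep_eq residues_of_of_nat del: of_nat_power) simp
    with N show False by simp
  qed
  then show ?thesis by (auto intro: finite_subset[OF _ finite_lessThan[of N]])
qed

lemma padic_val_dvd:
  fixes x :: "'p::prime_card padic_int"
  assumes "x \<noteq> 0"
  shows "of_nat CARD('p) ^ padic_val x dvd x"
proof -
  have "padic_val x \<in> {n. of_nat CARD('p) ^ n dvd x}"
    unfolding padic_val_def
    by (rule Max_in[OF finite_padic_val[OF assms]]) (auto intro: exI[of _ 0])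
  then show ?thesis by simp
qed

lemma padic_val_geI:
  fixes x :: "'p::prime_card padic_int"
  assumes "x \<noteq> 0" "of_nat CARD('p) ^ n dvd x"
  shows "n \<le> padic_val x"
  unfolding padic_val_def using assms by (intro Max_ge finite_padic_val) auto

lemma padic_abs_nonneg: "padic_abs x \<ge> 0"
  by (simp add: padic_abs_def)

lemma padic_abs_minus: "padic_abs (- x) = padic_abs x"
  by (simp add: padic_abs_def padic_val_def)

lemma padic_abs_add_le_max:
  fixes x y :: "'p::prime_card padic_int"
  shows "padic_abs (x + y) \<le> max (padic_abs x) (padic_abs y)"
proof (cases "x = 0 \<or> y = 0 \<or> x + y = 0")
  case True
  then show ?thesis
    by (auto simp: padic_abs_def le_max_iff_disj)
next
  case False
  let ?m = "min (padic_val x) (padic_val y)"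
  have p: "real CARD('p) > 1" using prime_gt_1_nat[OF prime_card[where ?'a = 'p]] by simp
  have "of_nat CARD('p) ^ ?m dvd x + y"
    using False by (intro dvd_add power_le_dvd[OF padic_val_dvd]) simp_all
  with False have "?m \<le> padic_val (x + y)" by (intro padic_val_geI) auto
  then have "1 / real CARD('p) ^ padic_val (x + y) \<le> 1 / real CARD('p) ^ ?m"
    using p by (intro divide_left_mono power_increasing) auto
  also have "\<dots> \<le> max (padic_abs x) (padic_abs y)"
    using False by (auto simp: padic_abs_def min_def)
  finally show ?thesis using False by (simp add: padic_abs_def)
qed

instantiation padic_int :: (prime_card) metric_space
begin

definition dist_padic_int :: "'a padic_int \<Rightarrow> 'a padic_int \<Rightarrow> real" where
  "dist x y = padic_abs (x - y)"

definition uniformity_padic_int :: "('a padic_int \<times> 'a padic_int) filter" where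
  "uniformity = (INF e\<in>{0<..}. principal {(x :: 'a padic_int, y). dist x y < e})"

definition open_padic_int :: "'a padic_int set \<Rightarrow> bool" where
  "open (U :: 'a padic_int set) \<longleftrightarrow> (\<forall>x\<in>U. eventually (\<lambda>(x', y). x' = x \<longrightarrow> y \<in> U) uniformity)"

instance
proof
  fix x y z :: "'a padic_int"
  show "dist x y = 0 \<longleftrightarrow> x = y"
    by (auto simp: dist_padic_int_def padic_abs_def)
  have "dist x y \<le> max (padic_abs (x - z)) (padic_abs (z - y))"
    using padic_abs_add_le_max[of "x - z" "z - y"] by (simp add: dist_padic_int_def)
  also have "\<dots> \<le> padic_abs (x - z) + padic_abs (y - z)"
    using padic_abs_nonneg[of "x - z"] padic_abs_nonneg[of "y - z"] padic_abs_minus[of "y - z"]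
    by simp
  finally show "dist x y \<le> dist x z + dist y z" by (simp add: dist_padic_int_def)
qed (rule uniformity_padic_int_def open_padic_int_def)+

end

definition least_residue :: "'p::prime_card padic_int \<Rightarrow> nat" where
  "least_residue a = (LEAST r. of_nat CARD('p) dvd a - of_nat r)"

text \<open>
  Morita's \<open>p\<close>-adic Gamma function. The filter \<open>filtercomap of_nat (nhds x)\<close> expresses that the
  natural number \<open>m\<close> tends to \<open>x\<close> in the \<open>p\<close>-adic metric.
\<close>

definition padic_Gamma :: "'p::prime_card padic_int \<Rightarrow> 'p padic_int" where
  "padic_Gamma x = Lim (filtercomap of_nat (nhds x))
     (\<lambda>m. (- 1) ^ m * of_nat (\<Prod>k | 0 < k \<and> k < m \<and> coprime k CARD('p). k))"

end

theory Submission
  imports Defs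
begin

text \<open>
  Modulo \<open>p\<^sup>2\<close>, both sides are affine functions of \<open>t\<close> along \<open>a = r + p t\<close>, and both are invariant
  under \<open>a \<mapsto> -1 - a\<close>. With \<open>r = \<langle>a\<rangle>\<^sub>p\<close> it therefore suffices to compare them at \<open>t = 0\<close> and at
  \<open>t = -1\<close>, that is, at the natural numbers \<open>r\<close> and \<open>p - 1 - r\<close>, which are both even and less
  than \<open>p\<close>. At \<open>2 n\<close> the left-hand side is the value at \<open>0\<close> of the Legendre polynomial of degree
  \<open>2 n\<close>, namely \<open>(-1)\<^sup>n (2n choose n) / 4\<^sup>n\<close>, and the right-hand side takes the same value by the
  functional equation of \<open>\<Gamma>\<^sub>p\<close> and \<open>\<Gamma>\<^sub>p(1/2)\<^sup>2 \<equiv> (-1)\<^bsup>(p+1)/2\<^esup>\<close>.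
\<close>

section \<open>Congruences and functions that are affine modulo a square\<close>

text \<open>Defined by divisibility alone, so that one calculus serves \<open>int\<close> and the
  \<open>p\<close>-adic integers.\<close>

definition ring_cong :: "'a::comm_ring_1 \<Rightarrow> 'a \<Rightarrow> 'a \<Rightarrow> bool" where
  "ring_cong q x y \<longleftrightarrow> q dvd x - y"

lemma ring_cong_refl [simp, intro]: "ring_cong q x x"
  by (simp add: ring_cong_def)

lemma ring_cong_sym: "ring_cong q x y \<Longrightarrow> ring_cong q y x"
  unfolding ring_cong_def using dvd_minus_iff[of q "x - y"] by simp

lemma ring_cong_trans [trans]: "ring_cong q x y \<Longrightarrow> ring_cong q y z \<Longrightarrow> ring_cong q x z"
  unfolding ring_cong_def using dvd_add[of q "x - y" "y - z"] by simp

lemma ring_cong_add: "ring_cong q x y \<Longrightarrow> ring_cong q u v \<Longrightarrow> ring_cong q (x + u) (y + v)"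
  unfolding ring_cong_def using dvd_add[of q "x - y" "u - v"] by (simp add: algebra_simps)

lemma ring_cong_uminus: "ring_cong q x y \<Longrightarrow> ring_cong q (- x) (- y)"
  unfolding ring_cong_def using dvd_minus_iff[of q "x - y"] by (simp add: algebra_simps)

lemma ring_cong_diff: "ring_cong q x y \<Longrightarrow> ring_cong q u v \<Longrightarrow> ring_cong q (x - u) (y - v)"
  using ring_cong_add[of q x y "- u" "- v"] ring_cong_uminus[of q u v] by simp

lemma ring_cong_mult:
  assumes "ring_cong q x y" "ring_cong q u v"
  shows "ring_cong q (x * u) (y * v)"
proof -
  have "x * u - y * v = (x - y) * u + y * (u - v)" by (simp add: algebra_simps)
  then show ?thesis using assms by (simp add: ring_cong_def)
qed

lemma ring_cong_prod:
  "(\<And>i. i \<in> A \<Longrightarrow> ring_cong q (f i) (g i)) \<Longrightarrow> ring_cong q (prod f A) (prod g A)"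
  by (induction A rule: infinite_finite_induct) (auto intro: ring_cong_mult)

lemma ring_cong_dvd_modulus: "ring_cong q x y \<Longrightarrow> r dvd q \<Longrightarrow> ring_cong r x y"
  unfolding ring_cong_def by (rule dvd_trans)

lemma ring_cong_mult_modulus: "ring_cong q x y \<Longrightarrow> ring_cong (r * q) (r * x) (r * y)"
  unfolding ring_cong_def by (metis mult_dvd_mono dvd_refl right_diff_distrib)

lemma ring_cong_dvd_iff: "ring_cong q x y \<Longrightarrow> q dvd x \<longleftrightarrow> q dvd y"
  unfolding ring_cong_def using dvd_add[of q "x - y" y] dvd_diff[of q x "x - y"] by auto

lemma ring_cong_cancel:
  assumes "ring_cong q (u * x) (u * y)" and "u dvd 1"
  shows "ring_cong q x y"
proof -
  obtain v where v: "1 = u * v" using assms(2) by (rule dvdE)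
  have "ring_cong q (v * (u * x)) (v * (u * y))"
    by (intro ring_cong_mult assms(1) ring_cong_refl)
  moreover have "v * (u * z) = z" for z
    using v by (metis mult.assoc mult.commute mult_1_left)
  ultimately show ?thesis by simp
qed

text \<open>The slope \<open>B\<close> does not depend on \<open>y\<close>. The factor
  \<open>q\<close> in front of \<open>y\<close> is what makes the notion stable under
  products.\<close>

definition affine_mod :: "'a::comm_ring_1 \<Rightarrow> ('a \<Rightarrow> 'a) \<Rightarrow> bool" where
  "affine_mod q f \<longleftrightarrow> (\<exists>B. \<forall>y. ring_cong (q ^ 2) (f y) (f 0 + q * y * B))"

lemma affine_modE:
  assumes "affine_mod q f"
  obtains B where "\<And>y. ring_cong (q ^ 2) (f y) (f 0 + q * y * B)"
  using assms unfolding affine_mod_def by blast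

text \<open>Evaluation at \<open>0\<close> shows that any admissible constant term \<open>A\<close>
  agrees with \<open>f 0\<close> modulo \<open>q ^ 2\<close>.\<close>

lemma affine_modI:
  assumes "\<And>y. ring_cong (q ^ 2) (f y) (A + q * y * B)"
  shows "affine_mod q f"
  unfolding affine_mod_def
proof (intro exI allI)
  fix y
  have "ring_cong (q ^ 2) (f 0) A" using assms[of 0] by simp
  then have "ring_cong (q ^ 2) (A + q * y * B) (f 0 + q * y * B)"
    by (intro ring_cong_add ring_cong_refl) (rule ring_cong_sym)
  with assms[of y] show "ring_cong (q ^ 2) (f y) (f 0 + q * y * B)" by (rule ring_cong_trans)
qed

lemma affine_mod_const: "affine_mod q (\<lambda>y. c)"
  by (rule affine_modI[where A = c and B = 0]) simp

lemma affine_mod_linear: "affine_mod q (\<lambda>y. c + q * y * d)"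
  by (rule affine_modI[where A = c and B = d]) simp

lemma affine_mod_add:
  assumes "affine_mod q f" "affine_mod q g"
  shows "affine_mod q (\<lambda>y. f y + g y)"
proof -
  obtain B where B: "\<And>y. ring_cong (q ^ 2) (f y) (f 0 + q * y * B)"
    using assms(1) by (rule affine_modE) blast
  obtain C where C: "\<And>y. ring_cong (q ^ 2) (g y) (g 0 + q * y * C)"
    using assms(2) by (rule affine_modE) blast
  show ?thesis
  proof (rule affine_modI[where A = "f 0 + g 0" and B = "B + C"])
    fix y
    show "ring_cong (q ^ 2) (f y + g y) (f 0 + g 0 + q * y * (B + C))"
      using ring_cong_add[OF B C, of y y] by (simp add: algebra_simps)
  qed
qed

text \<open>The only quadratic term of the product of two affine expressions carries the factor
  \<open>q ^ 2\<close>.\<close>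

lemma affine_mod_mult:
  assumes "affine_mod q f" "affine_mod q g"
  shows "affine_mod q (\<lambda>y. f y * g y)"
proof -
  obtain B where B: "\<And>y. ring_cong (q ^ 2) (f y) (f 0 + q * y * B)"
    using assms(1) by (rule affine_modE) blast
  obtain C where C: "\<And>y. ring_cong (q ^ 2) (g y) (g 0 + q * y * C)"
    using assms(2) by (rule affine_modE) blast
  show ?thesis
  proof (rule affine_modI[where A = "f 0 * g 0" and B = "f 0 * C + g 0 * B"])
    fix y
    have "(f 0 + q * y * B) * (g 0 + q * y * C) - (f 0 * g 0 + q * y * (f 0 * C + g 0 * B))
        = q ^ 2 * (y ^ 2 * B * C)"
      by (simp add: algebra_simps power2_eq_square)
    then have "ring_cong (q ^ 2) ((f 0 + q * y * B) * (g 0 + q * y * C))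
        (f 0 * g 0 + q * y * (f 0 * C + g 0 * B))"
      by (simp add: ring_cong_def)
    with ring_cong_mult[OF B C, of y y]
    show "ring_cong (q ^ 2) (f y * g y) (f 0 * g 0 + q * y * (f 0 * C + g 0 * B))"
      by (rule ring_cong_trans)
  qed
qed

lemma affine_mod_uminus: "affine_mod q f \<Longrightarrow> affine_mod q (\<lambda>y. - f y)"
  using affine_mod_mult[OF affine_mod_const[of q "- 1"], of f] by simp

lemma affine_mod_diff: "affine_mod q f \<Longrightarrow> affine_mod q g \<Longrightarrow> affine_mod q (\<lambda>y. f y - g y)"
  using affine_mod_add[OF _ affine_mod_uminus[of q g], of f] by simp

lemma affine_mod_sum:
  "(\<And>i. i \<in> A \<Longrightarrow> affine_mod q (f i)) \<Longrightarrow> affine_mod q (\<lambda>y. \<Sum>i\<in>A. f i y)"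
  by (induction A rule: infinite_finite_induct) (auto intro: affine_mod_add affine_mod_const)

lemma affine_mod_prod:
  "(\<And>i. i \<in> A \<Longrightarrow> affine_mod q (f i)) \<Longrightarrow> affine_mod q (\<lambda>y. \<Prod>i\<in>A. f i y)"
  by (induction A rule: infinite_finite_induct) (auto intro: affine_mod_mult affine_mod_const)

lemma affine_mod_compose_linear:
  assumes "affine_mod q f"
  shows "affine_mod q (\<lambda>y. f (c + y * d))"
proof -
  obtain B where B: "\<And>y. ring_cong (q ^ 2) (f y) (f 0 + q * y * B)"
    using assms by (rule affine_modE) blast
  show ?thesis
  proof (rule affine_modI[where A = "f 0 + q * c * B" and B = "d * B"])
    fix y
    show "ring_cong (q ^ 2) (f (c + y * d)) (f 0 + q * c * B + q * y * (d * B))"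
      using B[of "c + y * d"] by (simp add: algebra_simps)
  qed
qed

text \<open>The values at \<open>0\<close> and \<open>- 1\<close> differ by \<open>q * B\<close>
  modulo \<open>q ^ 2\<close>, so their vanishing removes both the constant and the linear term.
  This interpolation reduces a congruence for all \<open>y\<close> to two points.\<close>

lemma affine_mod_eq_zero:
  assumes "affine_mod q f" "q ^ 2 dvd f 0" "q ^ 2 dvd f (- 1)"
  shows "q ^ 2 dvd f y"
proof -
  obtain B where B: "\<And>y. ring_cong (q ^ 2) (f y) (f 0 + q * y * B)"
    using assms(1) by (rule affine_modE) blast
  have "q ^ 2 dvd f 0 + q * (- 1) * B" using B[of "- 1"] assms(3) ring_cong_dvd_iff by blast
  then have "q ^ 2 dvd q * B" using dvd_diff[OF assms(2)] by fastforce
  then have "q ^ 2 dvd f 0 + (q * B) * y" by (rule dvd_add[OF assms(2) dvd_mult2])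
  then show ?thesis using ring_cong_dvd_iff[OF B[of y]] by (simp add: mult_ac)
qed

section \<open>The Morita product on natural numbers\<close>

text \<open>Makes the functional equation of the Gamma function uniform:
  \<open>- unit_part q x\<close> is the factor from \<open>x\<close> to \<open>x + 1\<close>, also
  at multiples of \<open>p\<close>, where it is \<open>- 1\<close>.\<close>

definition unit_part :: "'a::comm_ring_1 \<Rightarrow> 'a \<Rightarrow> 'a" where
  "unit_part q x = (if q dvd x then 1 else x)"

lemma unit_part_cong:
  assumes "ring_cong r x y" "q dvd r"
  shows "ring_cong r (unit_part q x) (unit_part q y)"
  using assms ring_cong_dvd_iff[OF ring_cong_dvd_modulus[OF assms]] by (auto simp: unit_part_def)

text \<open>The product in Morita's limit, with the sign \<open>(- 1) ^ m\<close> distributed over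
  its \<open>m\<close> factors. The index \<open>0\<close> is a multiple of \<open>p\<close> and
  contributes only a sign.\<close>

definition morita :: "nat \<Rightarrow> nat \<Rightarrow> int" where
  "morita p m = (\<Prod>k<m. - unit_part (int p) (int k))"

lemma morita_0 [simp]: "morita p 0 = 1"
  by (simp add: morita_def)

lemma morita_Suc: "morita p (Suc m) = - unit_part (int p) (int m) * morita p m"
  by (simp add: morita_def)

lemma morita_add:
  "morita p (m + n) = morita p m * (\<Prod>i<n. - unit_part (int p) (int (m + i)))"
  by (induction n) (auto simp: morita_Suc)

lemma morita_eq:
  assumes "prime p"
  shows "(- 1) ^ m * int (\<Prod>k | 0 < k \<and> k < m \<and> coprime k p. k) = morita p m"
proof (induction m)
  case 0
  show ?case by simp
next
  case (Suc m)
  have cop: "coprime m p \<longleftrightarrow> \<not> int p dvd int m"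
    using assms by (metis coprime_commute int_dvd_int_iff prime_imp_coprime not_prime_unit
        coprime_absorb_left)
  have fin: "finite {k. 0 < k \<and> k < m \<and> coprime k p}" by simp
  show ?case
  proof (cases "int p dvd int m")
    case True
    then have "{k. 0 < k \<and> k < Suc m \<and> coprime k p} = {k. 0 < k \<and> k < m \<and> coprime k p}"
      using cop by (auto simp: less_Suc_eq)
    then show ?thesis using Suc True by (simp add: morita_Suc unit_part_def)
  next
    case False
    then have "m > 0" by (cases m) auto
    with False have "{k. 0 < k \<and> k < Suc m \<and> coprime k p}
        = insert m {k. 0 < k \<and> k < m \<and> coprime k p}"
      using cop by (auto simp: less_Suc_eq)
    moreover have "m \<notin> {k. 0 < k \<and> k < m \<and> coprime k p}" by simp
    ultimately show ?thesis using Suc False fin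
      by (simp add: morita_Suc unit_part_def algebra_simps)
  qed
qed

text \<open>These are the \<open>N\<close> consecutive factors starting at \<open>N * j\<close>. The
  index is an integer so that the block at \<open>- 1\<close> is available for
  interpolation.\<close>

definition morita_block :: "nat \<Rightarrow> nat \<Rightarrow> int \<Rightarrow> int" where
  "morita_block p N j = (\<Prod>i<N. - unit_part (int p) (int i + int N * j))"

text \<open>Since \<open>p\<close> divides \<open>N\<close>, whether a factor is replaced by
  \<open>1\<close> depends only on \<open>i\<close>; each factor is therefore constant or linear in
  \<open>j\<close>.\<close>

lemma affine_morita_block:
  assumes "p dvd N"
  shows "affine_mod (int N) (morita_block p N)"
  unfolding morita_block_def
proof (rule affine_mod_prod, rule affine_mod_uminus)
  fix i
  have "int p dvd int i + int N * j \<longleftrightarrow> int p dvd int i" for j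
    using assms by (simp add: dvd_add_left_iff)
  then have "(\<lambda>j. unit_part (int p) (int i + int N * j))
      = (\<lambda>j. unit_part (int p) (int i) + int N * j * (if int p dvd int i then 0 else 1))"
    by (auto simp: unit_part_def)
  then show "affine_mod (int N) (\<lambda>j. unit_part (int p) (int i + int N * j))"
    by (simp add: affine_mod_linear)
qed

lemma morita_block_0: "morita_block p N 0 = morita p N"
  by (simp add: morita_block_def morita_def)

lemma morita_mult_eq_prod_blocks: "morita p (N * t) = (\<Prod>j<t. morita_block p N (int j))"
proof (induction t)
  case 0
  show ?case by simp
next
  case (Suc t)
  have "morita p (N * Suc t) = morita p (N * t + N)" by (simp add: algebra_simps)
  also have "\<dots> = morita p (N * t) * morita_block p N (int t)"
    unfolding morita_add morita_block_def by (simp add: add.commute)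
  finally show ?case using Suc by simp
qed

lemma prod_one_plus_cong:
  fixes q :: "'a::comm_ring_1"
  shows "finite A \<Longrightarrow> ring_cong (q ^ 2) (\<Prod>i\<in>A. 1 + q * f i) (1 + q * (\<Sum>i\<in>A. f i))"
proof (induction A rule: finite_induct)
  case (insert x A)
  have "ring_cong (q ^ 2) ((1 + q * f x) * (\<Prod>i\<in>A. 1 + q * f i))
      ((1 + q * f x) * (1 + q * (\<Sum>i\<in>A. f i)))"
    by (intro ring_cong_mult insert.IH ring_cong_refl)
  also have "ring_cong (q ^ 2) \<dots> (1 + q * (f x + (\<Sum>i\<in>A. f i)))"
  proof -
    have "(1 + q * f x) * (1 + q * (\<Sum>i\<in>A. f i)) - (1 + q * (f x + (\<Sum>i\<in>A. f i)))
        = q ^ 2 * (f x * (\<Sum>i\<in>A. f i))"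
      by (simp add: algebra_simps power2_eq_square)
    then show ?thesis by (simp add: ring_cong_def)
  qed
  finally show ?case using insert by simp
qed simp

text \<open>This is Wilson's theorem: for odd \<open>p\<close> the sign \<open>(- 1) ^ p\<close>
  turns the residue \<open>- 1\<close> of \<open>fact (p - 1)\<close> into \<open>1\<close>.\<close>

lemma morita_prime:
  assumes "prime p" "odd p"
  shows "ring_cong (int p) (morita p p) 1"
proof -
  have "{k. 0 < k \<and> k < p \<and> coprime k p} = {1..p - 1}"
    using assms(1) prime_gt_0_nat[OF assms(1)]
    by (auto simp: coprime_commute[of _ p] intro!: prime_imp_coprime dest: dvd_imp_le)
  then have "morita p p = - int (fact (p - 1))"
    using morita_eq[OF assms(1), of p] assms(2) by (simp add: fact_prod)
  moreover have "ring_cong (int p) (fact (p - 1)) (- 1)"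
    using wilson_theorem[OF assms(1)] by (simp add: ring_cong_def cong_iff_dvd_diff)
  ultimately show ?thesis
    using ring_cong_uminus by fastforce
qed

text \<open>Wilson's theorem lifts from \<open>N = p\<^sup>n\<close> to \<open>p * N\<close> because the \<open>p\<close> blocks of length \<open>N\<close>
  are affine in their index modulo \<open>N\<^sup>2\<close> and \<open>\<Sum>j<p. j\<close> is divisible by the odd number \<open>p\<close>.\<close>

lemma morita_prime_power:
  assumes "prime p" "odd p"
  shows "ring_cong (int p ^ n) (morita p (p ^ n)) 1"
proof (induction n)
  case 0
  show ?case by (simp add: ring_cong_def)
next
  case (Suc n)
  show ?case
  \<comment> \<open>For \<open>n = 0\<close> the blocks have length \<open>1\<close>, which
    \<open>p\<close> does not divide; that case is Wilson's theorem itself.\<close>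
  proof (cases n)
    case 0
    then show ?thesis using morita_prime[OF assms] by simp
  next
    case (Suc n')
    define N where "N = p ^ n"
    have pN: "p dvd N" by (simp add: N_def Suc)
    obtain B where B: "\<And>j. ring_cong (int N ^ 2) (morita_block p N j) (morita p N + int N * j * B)"
      using affine_morita_block[OF pN] by (rule affine_modE) (auto simp: morita_block_0)
    obtain e where e: "morita p N = 1 + int N * e"
      using Suc.IH unfolding ring_cong_def N_def by (metis add.commute diff_add_cancel dvdE of_nat_power)
    have "ring_cong (int N ^ 2) (morita p (N * p)) (\<Prod>j<p. 1 + int N * (e + int j * B))"
      unfolding morita_mult_eq_prod_blocks
    proof (rule ring_cong_prod)
      fix j
      show "ring_cong (int N ^ 2) (morita_block p N (int j)) (1 + int N * (e + int j * B))"
        using B[of "int j"] unfolding e by (simp add: algebra_simps)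
    qed
    also have "ring_cong (int N ^ 2) \<dots> (1 + int N * (\<Sum>j<p. e + int j * B))"
      by (rule prod_one_plus_cong) simp
    finally have *: "ring_cong (int N ^ 2) (morita p (N * p)) (1 + int N * (\<Sum>j<p. e + int j * B))" .
    have dvd: "int p * int N dvd int N ^ 2"
      using pN by (simp add: power2_eq_square)
    \<comment> \<open>Twice the sum is evaluated to stay within the integers; the factor
      \<open>2\<close> is removed afterwards because \<open>p\<close> is odd.\<close>
    have gauss: "2 * (\<Sum>j<t. e + int j * B) = int t * (2 * e + (int t - 1) * B)" for t :: nat
      by (induction t) (auto simp: algebra_simps)
    have "int p dvd 2 * (\<Sum>j<p. e + int j * B)" unfolding gauss by simp
    moreover have "coprime (int p) 2" using assms(2) by simp
    ultimately have "int p dvd (\<Sum>j<p. e + int j * B)" by (simp add: coprime_dvd_mult_right_iff)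
    then have "ring_cong (int p * int N) (1 + int N * (\<Sum>j<p. e + int j * B)) 1"
      by (simp add: ring_cong_def mult.commute)
    with ring_cong_dvd_modulus[OF * dvd] show ?thesis
      using ring_cong_trans by (fastforce simp: N_def mult.commute)
  qed
qed

text \<open>For a shift by \<open>p ^ n\<close>, induction on \<open>m\<close> starts from
  \<open>morita_prime_power\<close> and multiplies both sides by congruent factors. This periodicity
  is what makes Morita's limit exist.\<close>

lemma morita_periodic:
  assumes "prime p" "odd p"
  shows "ring_cong (int p ^ n) (morita p (m + p ^ n * t)) (morita p m)"
proof (cases "n = 0")
  case True
  then show ?thesis by (simp add: ring_cong_def)
next
  case False
  have step: "ring_cong (int p ^ n) (morita p (m + p ^ n)) (morita p m)" for m
  proof (induction m)
    case 0
    then show ?case using morita_prime_power[OF assms] by simp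
  next
    case (Suc m)
    have "ring_cong (int p ^ n) (int (m + p ^ n)) (int m)" by (simp add: ring_cong_def)
    then have "ring_cong (int p ^ n) (unit_part (int p) (int (m + p ^ n))) (unit_part (int p) (int m))"
      using False by (intro unit_part_cong) (auto intro: dvd_power)
    from ring_cong_mult[OF ring_cong_uminus[OF this] Suc] show ?case
      by (simp add: morita_Suc)
  qed
  show ?thesis
  proof (induction t)
    case (Suc t)
    have "ring_cong (int p ^ n) (morita p (m + p ^ n * t + p ^ n)) (morita p (m + p ^ n * t))"
      by (rule step)
    also note Suc
    finally show ?case by (simp add: algebra_simps)
  qed simp
qed

text \<open>The blocks with index \<open>0\<close> and \<open>-1\<close> are exchanged by \<open>u \<mapsto> p - u\<close>; hence the linear
  coefficient of the block product vanishes modulo \<open>p\<^sup>2\<close>.\<close>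

lemma morita_block_prime:
  assumes "prime p" "odd p"
  shows "ring_cong (int p ^ 2) (morita_block p p j) (morita p p)"
proof -
  have "morita_block p p (- 1) = morita_block p p 0"
  proof -
    have p0: "p > 0" using prime_gt_0_nat[OF assms(1)] .
    have *: "morita_block p p j = - unit_part (int p) (int p * j)
        * (\<Prod>i\<in>{1..<p}. - unit_part (int p) (int i + int p * j))" for j
    proof -
      have "{..<p} = insert 0 {1..<p}" using p0 by auto
      then show ?thesis by (simp add: morita_block_def)
    qed
    have "(\<Prod>i\<in>{1..<p}. - unit_part (int p) (int i + int p * (- 1)))
        = (\<Prod>i\<in>{1..<p}. unit_part (int p) (int i + int p * 0))"
    proof (rule prod.reindex_bij_witness[of _ "\<lambda>i. p - i" "\<lambda>i. p - i"])
      fix i assume i: "i \<in> {1..<p}"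
      then have "\<not> int p dvd int p - int i" by (auto dest!: zdvd_imp_le)
      moreover from this have "\<not> int p dvd int i - int p" by (metis dvd_minus_iff minus_diff_eq)
      ultimately show "unit_part (int p) (int (p - i) + int p * 0)
          = - unit_part (int p) (int i + int p * (- 1))"
        using i by (simp add: unit_part_def of_nat_diff)
    qed auto
    \<comment> \<open>There are \<open>p - 1\<close> factors, an even number, so the signs
      cancel.\<close>
    also have "\<dots> = (\<Prod>i\<in>{1..<p}. - unit_part (int p) (int i + int p * 0))"
      using assms(2) by (simp add: prod_uminus)
    finally show ?thesis unfolding * by (simp add: unit_part_def)
  qed
  then have "affine_mod (int p) (\<lambda>j. morita_block p p j - morita p p)"
    "int p ^ 2 dvd morita_block p p 0 - morita p p"
    "int p ^ 2 dvd morita_block p p (- 1) - morita p p"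
    by (simp_all add: morita_block_0 affine_mod_diff affine_morita_block affine_mod_const)
  then show ?thesis unfolding ring_cong_def by (rule affine_mod_eq_zero)
qed

text \<open>Modulo \<open>p ^ 2\<close> all \<open>t\<close> blocks equal the same
  \<open>1 + p * w\<close>, and the \<open>t\<close>-th power of this is linear in \<open>t\<close>.
  It yields the affine behaviour of the Gamma function on multiples of \<open>p\<close>.\<close>

lemma morita_mult_prime:
  assumes "prime p" "odd p"
  obtains w where "\<And>t. ring_cong (int p ^ 2) (morita p (p * t)) (1 + int p * int t * w)"
proof -
  obtain w where w: "morita p p = 1 + int p * w"
    using morita_prime[OF assms] unfolding ring_cong_def by (metis add.commute diff_add_cancel dvdE)
  have "ring_cong (int p ^ 2) (morita p (p * t)) (1 + int p * int t * w)" for t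
  proof -
    have "ring_cong (int p ^ 2) (morita p (p * t)) (\<Prod>j<t. 1 + int p * w)"
      unfolding morita_mult_eq_prod_blocks
      by (rule ring_cong_prod) (use morita_block_prime[OF assms] w in simp)
    also have "ring_cong (int p ^ 2) \<dots> (1 + int p * (\<Sum>j<t. w))"
      by (rule prod_one_plus_cong) simp
    finally show ?thesis by (simp add: mult_ac)
  qed
  with that show ?thesis by blast
qed

section \<open>Residues, units and limits in the \<open>p\<close>-adic integers\<close>

text \<open>For the converse the quotient is built explicitly: its residue modulo
  \<open>p ^ m\<close> is the residue of \<open>x\<close> modulo \<open>p ^ (n + m)\<close>, divided
  by \<open>p ^ n\<close>.\<close>

lemma power_card_dvd_iff_residue:
  fixes x :: "'p::prime_card padic_int"
  shows "of_nat CARD('p) ^ n dvd x \<longleftrightarrow> residues_of x n = 0"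
proof
  assume "of_nat CARD('p) ^ n dvd x"
  then obtain y where "x = of_nat (CARD('p) ^ n) * y" by auto
  then show "residues_of x n = 0"
    by (simp add: times_padic_int.rep_eq residues_of_of_nat del: of_nat_power) simp
next
  let ?P = "int CARD('p)"
  assume *: "residues_of x n = 0"
  have P: "?P > 0" using prime_gt_0_nat[OF prime_card[where ?'a = 'p]] by simp
  define f where "f m = residues_of x (n + m) div ?P ^ n" for m
  have fm: "residues_of x (n + m) = ?P ^ n * f m" for m
    using * residues_of_eq_0_iff[of x n m] by (simp add: f_def)
  have comp: "\<forall>m. f (Suc m) mod ?P ^ m = f m"
  proof
    fix m
    have "?P ^ n * (f (Suc m) mod ?P ^ m) = (?P ^ n * f (Suc m)) mod (?P ^ n * ?P ^ m)"
      by (rule mult_mod_right)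
    also have "\<dots> = residues_of x (Suc (n + m)) mod ?P ^ (n + m)"
      using fm[of "Suc m"] by (simp add: power_add)
    also have "\<dots> = ?P ^ n * f m" using residues_of_Suc[of x "n + m"] fm[of m] by simp
    finally show "f (Suc m) mod ?P ^ m = f m" using P by simp
  qed
  define y where "y = (Abs_padic_int f :: 'p padic_int)"
  have y: "residues_of y = f" unfolding y_def using comp by (intro Abs_padic_int_inverse) simp
  have "residues_of x m = residues_of (of_nat (CARD('p) ^ n) * y) m" for m
  proof -
    have "residues_of x m = (?P ^ n * f m) mod ?P ^ m"
      using residues_of_add[of x m n] fm[of m] by (simp add: add.commute)
    then show ?thesis
      by (simp add: times_padic_int.rep_eq residues_of_of_nat y mod_simps del: of_nat_power) simp
  qed
  then have "x = of_nat (CARD('p) ^ n) * y" by (metis ext residues_of_inject)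
  then show "of_nat CARD('p) ^ n dvd x" by simp
qed

lemma residues_of_diff_eq_0_iff:
  fixes x y :: "'p::prime_card padic_int"
  shows "residues_of (x - y) n = 0 \<longleftrightarrow> residues_of x n = residues_of y n"
proof -
  have "residues_of (x - y) n = 0 \<longleftrightarrow> residues_of x n mod int CARD('p) ^ n = residues_of y n mod int CARD('p) ^ n"
    by (simp add: minus_padic_int.rep_eq mod_eq_dvd_iff dvd_eq_mod_eq_0)
  then show ?thesis by (simp add: residues_of_mod)
qed

lemma padic_cong_iff:
  fixes x y :: "'p::prime_card padic_int"
  shows "ring_cong (of_nat CARD('p) ^ n) x y \<longleftrightarrow> residues_of x n = residues_of y n"
  unfolding ring_cong_def power_card_dvd_iff_residue residues_of_diff_eq_0_iff ..

lemma padic_eqI: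
  fixes x y :: "'p::prime_card padic_int"
  assumes "\<And>n. ring_cong (of_nat CARD('p) ^ n) x y"
  shows "x = y"
  using assms unfolding padic_cong_iff by (metis ext residues_of_inject)

lemma residues_of_of_int:
  "residues_of (of_int k :: 'p::prime_card padic_int) n = k mod int CARD('p) ^ n"
proof (cases k)
  case (nonneg m)
  then show ?thesis by (simp add: residues_of_of_nat)
next
  case (neg m)
  have "of_int k = - (of_nat (Suc m) :: 'p padic_int)" by (simp add: neg)
  then show ?thesis
    by (simp only: uminus_padic_int.rep_eq residues_of_of_nat neg mod_simps)
qed

lemma of_int_cong_iff:
  "ring_cong (of_nat CARD('p) ^ n) (of_int k :: 'p::prime_card padic_int) (of_int l)
    \<longleftrightarrow> ring_cong (int CARD('p) ^ n) k l"
  unfolding padic_cong_iff residues_of_of_int by (simp add: ring_cong_def mod_eq_dvd_iff)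

lemma of_int_card_dvd_iff:
  "(of_nat CARD('p) :: 'p::prime_card padic_int) dvd of_int k \<longleftrightarrow> int CARD('p) dvd k"
  using of_int_cong_iff[where ?'p = 'p, of 1 k 0] by (simp add: ring_cong_def)

lemma residues_of_nonneg: "residues_of (x :: 'p::prime_card padic_int) n \<ge> 0"
proof -
  have "int CARD('p) ^ n > 0" using prime_gt_0_nat[OF prime_card[where ?'a = 'p]] by simp
  then have "residues_of x n mod int CARD('p) ^ n \<ge> 0" by (rule pos_mod_sign)
  then show ?thesis by (simp only: residues_of_mod)
qed

definition nat_residue :: "'p::prime_card padic_int \<Rightarrow> nat \<Rightarrow> nat" where
  "nat_residue x n = nat (residues_of x n)"

lemma nat_residue_cong:
  fixes x :: "'p::prime_card padic_int"
  shows "ring_cong (of_nat CARD('p) ^ n) x (of_nat (nat_residue x n))"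
  unfolding padic_cong_iff residues_of_of_nat nat_residue_def
  by (simp add: residues_of_nonneg residues_of_mod)

text \<open>Every residue of \<open>x\<close> is invertible modulo \<open>p ^ n\<close>, and
  uniqueness of inverses makes the chosen ones compatible.\<close>

lemma padic_unit:
  fixes x :: "'p::prime_card padic_int"
  assumes "\<not> of_nat CARD('p) dvd x"
  shows "x dvd 1"
proof -
  let ?P = "int CARD('p)"
  have P: "prime ?P" using prime_card[where ?'a = 'p] by simp
  have cop: "coprime (residues_of x n) (?P ^ n)" for n
  proof (cases n)
    case (Suc m)
    have "\<not> ?P dvd residues_of x (1 + m)"
      using assms power_card_dvd_iff_residue[of 1 x] residues_of_eq_0_iff[of x 1 m] by simp
    then have "coprime ?P (residues_of x n)"
      using P Suc by (intro prime_imp_coprime) auto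
    then show ?thesis by (simp add: coprime_commute)
  qed simp
  \<comment> \<open>The outer reduction turns an arbitrary inverse into the least residue that the
    type requires.\<close>
  define f where "f n = (SOME z. (residues_of x n * z) mod ?P ^ n = 1 mod ?P ^ n) mod ?P ^ n" for n
  have f: "(residues_of x n * f n) mod ?P ^ n = 1 mod ?P ^ n" for n
  proof -
    have "\<exists>z. [residues_of x n * z = 1] (mod ?P ^ n)"
      using cop by (rule cong_solve_coprime_int)
    then have "\<exists>z. (residues_of x n * z) mod ?P ^ n = 1 mod ?P ^ n" by (simp add: cong_def)
    from someI_ex[OF this] show ?thesis by (simp add: f_def mod_simps)
  qed
  have comp: "\<forall>n. f (Suc n) mod ?P ^ n = f n"
  proof
    fix n
    have "(residues_of x (Suc n) * f (Suc n)) mod ?P ^ n = 1 mod ?P ^ n"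
    proof -
      have "(residues_of x (Suc n) * f (Suc n)) mod ?P ^ Suc n mod ?P ^ n = 1 mod ?P ^ Suc n mod ?P ^ n"
        by (simp only: f)
      then show ?thesis by (simp add: mod_mod_cancel)
    qed
    then have "(residues_of x n * f (Suc n)) mod ?P ^ n = (residues_of x n * f n) mod ?P ^ n"
      using f[of n] residues_of_Suc[of x n] by (metis mod_mult_left_eq)
    then have "[residues_of x n * f (Suc n) = residues_of x n * f n] (mod ?P ^ n)"
      by (simp add: cong_def)
    then have "[f (Suc n) = f n] (mod ?P ^ n)"
      using cop by (simp add: cong_mult_lcancel)
    then show "f (Suc n) mod ?P ^ n = f n" by (simp add: cong_def f_def)
  qed
  define y where "y = (Abs_padic_int f :: 'p padic_int)"
  have y: "residues_of y = f" unfolding y_def using comp by (intro Abs_padic_int_inverse) simp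
  have "residues_of (x * y) n = residues_of (1 :: 'p padic_int) n" for n
    by (simp add: times_padic_int.rep_eq one_padic_int.rep_eq y f)
  then have "x * y = 1" by (metis ext residues_of_inject)
  then show ?thesis by (metis dvd_triv_left)
qed

section \<open>Comparison of the metric with congruences modulo powers of \<open>p\<close>\<close>

lemma dist_padic_le:
  fixes x y :: "'p::prime_card padic_int"
  assumes "ring_cong (of_nat CARD('p) ^ n) x y"
  shows "dist x y \<le> 1 / real CARD('p) ^ n"
proof (cases "x = y")
  case False
  then have "n \<le> padic_val (x - y)"
    using assms by (intro padic_val_geI) (auto simp: ring_cong_def)
  then have "1 / real CARD('p) ^ padic_val (x - y) \<le> 1 / real CARD('p) ^ n"
    using prime_gt_1_nat[OF prime_card[where ?'a = 'p]]
    by (intro divide_left_mono power_increasing) auto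
  then show ?thesis using False by (simp add: dist_padic_int_def padic_abs_def)
qed simp

text \<open>Nonzero distances are powers of \<open>1 / p\<close>, so a strict bound gains one
  exponent.\<close>

lemma padic_cong_if_dist_less:
  fixes x y :: "'p::prime_card padic_int"
  assumes "dist x y < 1 / real CARD('p) ^ n"
  shows "ring_cong (of_nat CARD('p) ^ Suc n) x y"
proof (cases "x = y")
  case False
  have p: "real CARD('p) > 1" using prime_gt_1_nat[OF prime_card[where ?'a = 'p]] by simp
  from assms False have "1 / real CARD('p) ^ padic_val (x - y) < 1 / real CARD('p) ^ n"
    by (simp add: dist_padic_int_def padic_abs_def)
  then have "real CARD('p) ^ n < real CARD('p) ^ padic_val (x - y)"
    using p by (simp add: frac_less2 divide_simps split: if_splits)
  then have "Suc n \<le> padic_val (x - y)"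
    using p by (metis Suc_leI power_less_imp_less_exp)
  then show ?thesis unfolding ring_cong_def
    using False by (intro power_le_dvd[OF padic_val_dvd]) auto
qed simp

lemma inverse_power_card_less:
  assumes "e > 0"
  obtains n where "1 / real CARD('p::prime_card) ^ n < e"
proof -
  have "1 / real CARD('p) < 1" using prime_gt_1_nat[OF prime_card[where ?'a = 'p]] by simp
  then obtain n where "(1 / real CARD('p)) ^ n < e"
    using real_arch_pow_inv[OF assms] by blast
  with that show ?thesis by (simp add: power_one_over)
qed

section \<open>The \<open>p\<close>-adic Gamma function\<close>

text \<open>The limit is constructed from the values of \<open>morita\<close> at natural
  approximations of \<open>x\<close>. By \<open>morita_periodic\<close> its residue modulo
  \<open>p ^ n\<close> does not depend on the approximation modulo \<open>p ^ n\<close>.\<close>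

lemma padic_Gamma_cong_morita:
  fixes x :: "'p::prime_card padic_int"
  assumes "odd CARD('p)" and "ring_cong (of_nat CARD('p) ^ n) x (of_nat m)"
  shows "ring_cong (of_nat CARD('p) ^ n) (padic_Gamma x) (of_int (morita CARD('p) m))"
proof -
  let ?p = "CARD('p)"
  have pr: "prime ?p" by (rule prime_card)
  have per: "ring_cong (int ?p ^ n) (morita ?p a) (morita ?p b)"
    if "int a mod int ?p ^ n = int b mod int ?p ^ n" for a b n
  proof -
    have "ring_cong (int ?p ^ n) (morita ?p a) (morita ?p b)"
      if ab: "int a mod int ?p ^ n = int b mod int ?p ^ n" "b \<le> a" for a b
    proof -
      have "a mod ?p ^ n = b mod ?p ^ n" using ab(1) by (metis of_nat_eq_iff of_nat_mod of_nat_power)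
      then obtain t where "a = b + ?p ^ n * t" using ab(2)
        by (metis dvdE le_add_diff_inverse mod_eq_dvd_iff_nat)
      then show ?thesis using morita_periodic[OF pr assms(1)] by simp
    qed
    then show ?thesis using that by (metis nat_le_linear ring_cong_sym)
  qed
  define f where "f n = morita ?p (nat_residue x n) mod int ?p ^ n" for n
  have comp: "\<forall>n. f (Suc n) mod int ?p ^ n = f n"
  proof
    fix n
    have "int (nat_residue x (Suc n)) mod int ?p ^ n = int (nat_residue x n) mod int ?p ^ n"
      by (simp add: nat_residue_def residues_of_nonneg residues_of_Suc residues_of_mod)
    from per[OF this] show "f (Suc n) mod int ?p ^ n = f n"
      by (simp add: f_def mod_mod_cancel ring_cong_def mod_eq_dvd_iff)
  qed
  define L where "L = (Abs_padic_int f :: 'p padic_int)"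
  have L: "residues_of L = f" unfolding L_def using comp by (intro Abs_padic_int_inverse) simp
  have cong: "ring_cong (of_nat ?p ^ n) L (of_int (morita ?p m))"
    if "ring_cong (of_nat ?p ^ n) x (of_nat m)" for n m
  proof -
    have "int (nat_residue x n) mod int ?p ^ n = int m mod int ?p ^ n"
      using that by (simp add: padic_cong_iff residues_of_of_nat nat_residue_def residues_of_nonneg)
    from per[OF this] show ?thesis
      unfolding padic_cong_iff L f_def residues_of_of_int
      by (simp add: ring_cong_def mod_eq_dvd_iff)
  qed
  let ?F = "filtercomap of_nat (nhds x) :: nat filter"
  \<comment> \<open>Natural numbers are dense in the \<open>p\<close>-adic integers; without a
    nontrivial filter the limit would not be unique.\<close>
  have "?F \<noteq> bot"
  proof (rule filtercomap_neq_bot)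
    fix P assume "eventually P (nhds x)"
    then obtain d where d: "d > 0" "\<And>y. dist y x < d \<Longrightarrow> P y" by (auto simp: eventually_nhds_metric)
    obtain n where "1 / real ?p ^ n < d" using inverse_power_card_less[OF d(1)] .
    then have "dist (of_nat (nat_residue x n)) x < d"
      using dist_padic_le[OF nat_residue_cong[of n x]] by (simp add: dist_commute)
    then show "\<exists>m. P (of_nat m)" using d(2) by blast
  qed
  moreover have "((\<lambda>m. (- 1) ^ m * of_nat (\<Prod>k | 0 < k \<and> k < m \<and> coprime k ?p. k)) \<longlongrightarrow> L) ?F"
  proof (rule tendstoI)
    fix e :: real assume "e > 0"
    then obtain n where n: "1 / real ?p ^ n < e" using inverse_power_card_less by blast
    have "eventually (\<lambda>y. dist y x < 1 / real ?p ^ n) (nhds x)"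
      unfolding eventually_nhds_metric using prime_gt_0_nat[OF pr]
      by (intro exI[of _ "1 / real ?p ^ n"]) simp
    moreover have "dist ((- 1) ^ m * of_nat (\<Prod>k | 0 < k \<and> k < m \<and> coprime k ?p. k)) L < e"
      if "dist (of_nat m) x < 1 / real ?p ^ n" for m
    proof -
      have "ring_cong (of_nat ?p ^ Suc n) x (of_nat m)"
        using that by (intro padic_cong_if_dist_less) (simp add: dist_commute)
      then have "ring_cong (of_nat ?p ^ n) x (of_nat m)"
        by (rule ring_cong_dvd_modulus) simp
      from dist_padic_le[OF cong[OF this]] n
      have "dist L (of_int (morita ?p m)) < e" by simp
      moreover have "(- 1) ^ m * of_nat (\<Prod>k | 0 < k \<and> k < m \<and> coprime k ?p. k)
          = (of_int (morita ?p m) :: 'p padic_int)"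
        unfolding morita_eq[OF pr, symmetric] by simp
      ultimately show ?thesis by (simp add: dist_commute)
    qed
    ultimately show "eventually (\<lambda>m. dist ((- 1) ^ m
        * of_nat (\<Prod>k | 0 < k \<and> k < m \<and> coprime k ?p. k)) L < e) ?F"
      unfolding eventually_filtercomap by blast
  qed
  ultimately have "padic_Gamma x = L"
    unfolding padic_Gamma_def by (rule tendsto_Lim)
  then show ?thesis using cong[OF assms(2)] by simp
qed

lemma padic_Gamma_cong:
  fixes x :: "'p::prime_card padic_int"
  assumes "odd CARD('p)" and "ring_cong (of_nat CARD('p) ^ n) x y"
  shows "ring_cong (of_nat CARD('p) ^ n) (padic_Gamma x) (padic_Gamma y)"
proof -
  have y: "ring_cong (of_nat CARD('p) ^ n) y (of_nat (nat_residue y n))" by (rule nat_residue_cong)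
  from padic_Gamma_cong_morita[OF assms(1) ring_cong_trans[OF assms(2) y]]
    ring_cong_sym[OF padic_Gamma_cong_morita[OF assms(1) y]]
  show ?thesis by (rule ring_cong_trans)
qed

lemma padic_Gamma_of_nat:
  assumes "odd CARD('p)"
  shows "padic_Gamma (of_nat m :: 'p::prime_card padic_int) = of_int (morita CARD('p) m)"
  by (rule padic_eqI, rule padic_Gamma_cong_morita[OF assms]) simp

lemma unit_part_of_nat:
  "unit_part (of_nat CARD('p)) (of_nat m :: 'p::prime_card padic_int)
    = of_int (unit_part (int CARD('p)) (int m))"
  using of_int_card_dvd_iff[where ?'p = 'p, of "int m"] by (simp add: unit_part_def)

text \<open>The recursion of \<open>morita\<close> is carried from natural numbers to
  \<open>x\<close> by approximation.\<close>

lemma padic_Gamma_plus_1: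
  fixes x :: "'p::prime_card padic_int"
  assumes "odd CARD('p)"
  shows "padic_Gamma (x + 1) = - unit_part (of_nat CARD('p)) x * padic_Gamma x"
proof (rule padic_eqI)
  fix n
  let ?q = "of_nat CARD('p) :: 'p padic_int"
  \<comment> \<open>The exponent \<open>Suc n\<close> ensures that \<open>p\<close> divides the
    modulus, as \<open>unit_part_cong\<close> demands, even for \<open>n = 0\<close>.\<close>
  define m where "m = nat_residue x (Suc n)"
  have m: "ring_cong (?q ^ Suc n) x (of_nat m)" unfolding m_def by (rule nat_residue_cong)
  have "ring_cong (?q ^ Suc n) (padic_Gamma (x + 1)) (padic_Gamma (of_nat m + 1))"
    by (intro padic_Gamma_cong assms ring_cong_add m ring_cong_refl)
  also have "padic_Gamma (of_nat m + 1) = - unit_part ?q (of_nat m) * padic_Gamma (of_nat m)"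
    using padic_Gamma_of_nat[OF assms, of "Suc m"] padic_Gamma_of_nat[OF assms, of m]
    by (simp add: morita_Suc unit_part_of_nat add.commute)
  also have "ring_cong (?q ^ Suc n) \<dots> (- unit_part ?q x * padic_Gamma x)"
    by (intro ring_cong_mult ring_cong_uminus unit_part_cong padic_Gamma_cong assms
        ring_cong_sym[OF m]) simp
  finally show "ring_cong (?q ^ n) (padic_Gamma (x + 1)) (- unit_part ?q x * padic_Gamma x)"
    by (rule ring_cong_dvd_modulus) simp
qed

lemma padic_Gamma_plus_1_unit:
  fixes x :: "'p::prime_card padic_int"
  assumes "odd CARD('p)" "\<not> of_nat CARD('p) dvd x"
  shows "padic_Gamma (x + 1) = - x * padic_Gamma x"
  using padic_Gamma_plus_1[OF assms(1), of x] assms(2) by (simp add: unit_part_def)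

lemma padic_Gamma_0:
  assumes "odd CARD('p)"
  shows "padic_Gamma (0 :: 'p::prime_card padic_int) = 1"
  using padic_Gamma_of_nat[OF assms, of 0] by simp

text \<open>On multiples of \<open>p\<close> this comes from \<open>morita_mult_prime\<close>. The
  functional equation moves the centre from \<open>s\<close> to \<open>s + 1\<close>, and a general
  \<open>x\<close> differs from a natural number by a multiple of \<open>p\<close>.\<close>

lemma affine_padic_Gamma:
  fixes x :: "'p::prime_card padic_int"
  assumes "odd CARD('p)"
  shows "affine_mod (of_nat CARD('p)) (\<lambda>y. padic_Gamma (x + of_nat CARD('p) * y))"
proof -
  let ?q = "of_nat CARD('p) :: 'p padic_int"
  have aff: "affine_mod ?q (\<lambda>y. padic_Gamma (of_nat s + ?q * y))" for s
  proof (induction s)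
    case 0
    obtain w where w: "\<And>t. ring_cong (int CARD('p) ^ 2) (morita CARD('p) (CARD('p) * t))
        (1 + int CARD('p) * int t * w)"
      using morita_mult_prime[OF prime_card assms] by blast
    have "ring_cong (?q ^ 2) (padic_Gamma (?q * y)) (1 + ?q * y * of_int w)" for y
    proof -
      \<comment> \<open>An approximation of \<open>y\<close> modulo \<open>p\<close> suffices,
        because \<open>y\<close> enters only through \<open>?q * y\<close>.\<close>
      define t where "t = nat_residue y 1"
      have t: "ring_cong ?q y (of_nat t)" using nat_residue_cong[of 1 y] by (simp add: t_def)
      have t': "ring_cong (?q ^ 2) (?q * y) (?q * of_nat t)"
        using ring_cong_mult_modulus[OF t, of ?q] by (simp add: power2_eq_square)
      have "ring_cong (?q ^ 2) (padic_Gamma (?q * y)) (of_int (morita CARD('p) (CARD('p) * t)))"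
        by (intro padic_Gamma_cong_morita assms) (use t' in simp)
      also have "ring_cong (?q ^ 2) \<dots> (of_int (1 + int CARD('p) * int t * w))"
        unfolding of_int_cong_iff by (rule w)
      also have "of_int (1 + int CARD('p) * int t * w) = 1 + ?q * of_nat t * of_int w" by simp
      also have "ring_cong (?q ^ 2) \<dots> (1 + ?q * y * of_int w)"
        by (intro ring_cong_add ring_cong_mult ring_cong_sym[OF t'] ring_cong_refl)
      finally show ?thesis .
    qed
    then have "affine_mod ?q (\<lambda>y. padic_Gamma (?q * y))" by (rule affine_modI)
    then show ?case by simp
  next
    case (Suc s)
    have "affine_mod ?q (\<lambda>y. unit_part ?q (of_nat s + ?q * y))"
    proof (cases "?q dvd of_nat s")
      case True
      then show ?thesis by (simp add: unit_part_def affine_mod_const)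
    next
      case False
      then have "(\<lambda>y. unit_part ?q (of_nat s + ?q * y)) = (\<lambda>y. of_nat s + ?q * y * 1)"
        by (auto simp: unit_part_def dvd_add_left_iff)
      then show ?thesis by (simp only: affine_mod_linear)
    qed
    from affine_mod_mult[OF affine_mod_uminus[OF this] Suc]
    have "affine_mod ?q (\<lambda>y. padic_Gamma (of_nat s + ?q * y + 1))"
      by (simp add: padic_Gamma_plus_1[OF assms])
    then show ?case by (simp add: add_ac)
  qed
  have "?q dvd x - of_nat (nat_residue x 1)"
    using nat_residue_cong[of 1 x] by (simp add: ring_cong_def)
  then obtain z where "x - of_nat (nat_residue x 1) = ?q * z" by (rule dvdE)
  then have x: "x = of_nat (nat_residue x 1) + ?q * z" by (simp add: algebra_simps)
  have "(\<lambda>y. padic_Gamma (x + ?q * y))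
      = (\<lambda>y. padic_Gamma (of_nat (nat_residue x 1) + ?q * (z + y * 1)))"
    by (subst x) (simp add: algebra_simps)
  then show ?thesis
    using affine_mod_compose_linear[OF aff[of "nat_residue x 1"], of z 1] by simp
qed

text \<open>The factors \<open>unit_part\<close> at \<open>x\<close> and at \<open>- x\<close> agree
  up to sign, and both are \<open>1\<close> at multiples of \<open>p\<close>.\<close>

lemma padic_Gamma_reflection_step:
  fixes x :: "'p::prime_card padic_int"
  assumes "odd CARD('p)"
  shows "padic_Gamma (x + 1) * padic_Gamma (- x)
    = (if of_nat CARD('p) dvd x then 1 else - 1) * (padic_Gamma x * padic_Gamma (1 - x))"
proof -
  let ?q = "of_nat CARD('p) :: 'p padic_int"
  have "padic_Gamma (1 - x) = - unit_part ?q (- x) * padic_Gamma (- x)"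
    using padic_Gamma_plus_1[OF assms, of "- x"] by simp
  then show ?thesis
    unfolding padic_Gamma_plus_1[OF assms] by (simp add: unit_part_def)
qed

text \<open>The value at \<open>m = 1\<close> is \<open>- 1\<close>, and every further step up to
  \<open>p\<close> flips the sign, as no multiple of \<open>p\<close> is passed.\<close>

lemma padic_Gamma_reflection_of_nat:
  assumes "odd CARD('p)" "1 \<le> m" "m \<le> CARD('p)"
  shows "padic_Gamma (of_nat m) * padic_Gamma (1 - of_nat m :: 'p::prime_card padic_int) = (- 1) ^ m"
  using assms(2,3)
proof (induction m rule: dec_induct)
  case base
  show ?case using padic_Gamma_0[OF assms(1)] padic_Gamma_plus_1[OF assms(1), of 0]
    by (simp add: unit_part_def)
next
  case (step m)
  have "\<not> int CARD('p) dvd int m" using step by (auto dest: dvd_imp_le)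
  then have "\<not> of_nat CARD('p) dvd (of_nat m :: 'p padic_int)"
    using of_int_card_dvd_iff[where ?'p = 'p, of "int m"] by simp
  then show ?case
    using step padic_Gamma_reflection_step[OF assms(1), of "of_nat m"] by (simp add: add.commute)
qed

text \<open>One period contains \<open>p - 1\<close> sign changes, an even number. The reflection
  product at a number near \<open>1/2\<close> can thus be read off below \<open>p\<close>.\<close>

lemma padic_Gamma_reflection_periodic:
  assumes "odd CARD('p)"
  shows "padic_Gamma (of_nat (m + CARD('p) * j)) * padic_Gamma (1 - of_nat (m + CARD('p) * j))
    = padic_Gamma (of_nat m) * padic_Gamma (1 - of_nat m :: 'p::prime_card padic_int)"
proof -
  let ?R = "\<lambda>m. padic_Gamma (of_nat m) * padic_Gamma (1 - of_nat m :: 'p padic_int)"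
  have step: "?R (m + CARD('p)) = ?R m" for m
  proof (induction m)
    case 0
    have "?R CARD('p) = (- 1) ^ CARD('p)"
      using prime_gt_0_nat[OF prime_card[where ?'a = 'p]]
      by (intro padic_Gamma_reflection_of_nat[OF assms]) auto
    moreover have "?R 0 = - 1"
      using padic_Gamma_0[OF assms] padic_Gamma_plus_1[OF assms, of 0] by (simp add: unit_part_def)
    ultimately show ?case using assms by simp
  next
    case (Suc m)
    then show ?case
      using padic_Gamma_reflection_step[OF assms, of "of_nat m"]
        padic_Gamma_reflection_step[OF assms, of "of_nat (m + CARD('p))"]
      by (simp add: add_ac)
  qed
  show ?thesis
  proof (induction j)
    case (Suc j)
    have "?R (m + CARD('p) * Suc j) = ?R (m + CARD('p) * j + CARD('p))"
      by (simp add: algebra_simps)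
    also have "\<dots> = ?R (m + CARD('p) * j)" by (rule step)
    finally show ?case using Suc by simp
  qed simp
qed

section \<open>Both sides at even natural numbers\<close>

lemma div_eq_mult_inverse:
  fixes x y v :: "'a::idom_divide"
  assumes "y * v = 1"
  shows "x div y = x * v"
proof -
  have "y \<noteq> 0" using assms by auto
  moreover have "x = y * (x * v)" using assms by (metis mult.left_commute mult_1_right)
  ultimately show ?thesis by (metis nonzero_mult_div_cancel_left)
qed

lemma mult_one_div:
  fixes y :: "'a::idom_divide"
  assumes "y dvd 1"
  shows "y * (1 div y) = 1"
proof -
  obtain v where v: "1 = y * v" using assms by (rule dvdE)
  then show ?thesis using div_eq_mult_inverse[of y v 1] by simp
qed

lemma of_nat_not_dvd:
  assumes "0 < k" "k < CARD('p)"
  shows "\<not> of_nat CARD('p) dvd (of_nat k :: 'p::prime_card padic_int)"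
  using of_int_card_dvd_iff[where ?'p = 'p, of "int k"] assms by (auto dest: dvd_imp_le)

lemma padic_fact_unit:
  assumes "k < CARD('p)"
  shows "(fact k :: 'p::prime_card padic_int) dvd 1"
  using assms
proof (induction k)
  case (Suc k)
  then have "(of_nat (Suc k) :: 'p padic_int) dvd 1" by (intro padic_unit of_nat_not_dvd) auto
  moreover have "(fact k :: 'p padic_int) dvd 1" using Suc by simp
  ultimately have "of_nat (Suc k) * fact k dvd (1 * 1 :: 'p padic_int)" by (rule mult_dvd_mono)
  then show ?case by simp
qed simp

lemma pochhammer_of_nat_plus_1:
  "pochhammer (of_nat m + 1 :: 'a::comm_semiring_1) k = of_nat (fact k * ((m + k) choose k))"
proof -
  have "pochhammer (Suc m) k * fact m = (fact (m + k) :: nat)"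
    by (induction k) (auto simp: pochhammer_rec' algebra_simps)
  also have "\<dots> = fact k * ((m + k) choose k) * fact m"
    using binomial_fact_lemma[of k "m + k"] by (simp add: mult_ac)
  finally have "pochhammer (Suc m) k = fact k * ((m + k) choose k)" by simp
  then show ?thesis using pochhammer_of_nat[of "Suc m" k, where ?'a = 'a] by (simp add: add.commute)
qed

lemma pochhammer_neg_of_nat:
  assumes "k \<le> N"
  shows "pochhammer (- of_nat N :: 'a::comm_ring_1) k = (- 1) ^ k * of_nat (fact k * (N choose k))"
proof -
  have "(of_nat N - of_nat k + 1 :: 'a) = of_nat (N - k) + 1" using assms by (simp add: of_nat_diff)
  then show ?thesis using assms by (simp only: pochhammer_minus pochhammer_of_nat_plus_1) simp
qed

text \<open>Both sides are the coefficient of \<open>X\<^sup>N\<close> in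
  \<open>(1 + X)\<^sup>N (2 - (1 + X))\<^sup>N = (1 - X\<^sup>2)\<^sup>N\<close> for \<open>N = 2 * n\<close>.\<close>

lemma central_Legendre_sum:
  "(\<Sum>k\<le>2 * n. int ((2 * n) choose k) * int ((2 * n + k) choose k) * (- 1) ^ k * 2 ^ (2 * n - k))
    = (- 1) ^ n * int ((2 * n) choose n)"
proof -
  define N where "N = 2 * n"
  let ?L = "[:1, 1:] :: int poly"
  have "(\<Sum>k\<le>N. of_nat (N choose k) * (- ?L) ^ k * 2 ^ (N - k)) * ?L ^ N = ((- ?L + 2) * ?L) ^ N"
    unfolding binomial_ring[symmetric] by (rule power_mult_distrib[symmetric])
  also have "(- ?L + 2) * ?L = monom (- 1) 2 + 1"
    by (simp add: monom_altdef power2_eq_square numeral_poly one_pCons)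
  also have "(monom (- 1) 2 + 1 :: int poly) ^ N
      = (\<Sum>k\<le>N. of_nat (N choose k) * monom ((- 1) ^ k) (2 * k))"
    by (simp add: binomial_ring monom_power)
  finally have eq: "(\<Sum>k\<le>N. of_nat (N choose k) * (- ?L) ^ k * 2 ^ (N - k)) * ?L ^ N
      = (\<Sum>k\<le>N. of_nat (N choose k) * monom ((- 1) ^ k) (2 * k))" .
  have c: "coeff (of_nat a * q) i = int a * coeff q i" for a q i
    by (simp add: of_nat_poly)
  have "coeff (of_nat (N choose k) * (- ?L) ^ k * 2 ^ (N - k) * ?L ^ N) N
      = int (N choose k) * int ((N + k) choose k) * (- 1) ^ k * 2 ^ (N - k)" for k
  proof -
    have "of_nat (N choose k) * (- ?L) ^ k * 2 ^ (N - k) * ?L ^ N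
        = smult (int (N choose k) * (- 1) ^ k * 2 ^ (N - k)) (?L ^ (N + k))"
    proof -
      have "(- ?L) ^ k = smult ((- 1) ^ k) (?L ^ k)"
        using smult_power[of "- 1" ?L k] by simp
      moreover have "(2 :: int poly) ^ (N - k) = [:2 ^ (N - k):]"
        by (simp add: numeral_poly poly_const_pow)
      ultimately show ?thesis
        by (simp add: of_nat_poly power_add mult_ac)
    qed
    then show ?thesis
      by (simp add: coeff_linear_poly_power binomial_symmetric[of N "N + k"])
  qed
  then have "(\<Sum>k\<le>N. int (N choose k) * int ((N + k) choose k) * (- 1) ^ k * 2 ^ (N - k))
      = coeff ((\<Sum>k\<le>N. of_nat (N choose k) * (- ?L) ^ k * 2 ^ (N - k)) * ?L ^ N) N"
    by (simp add: coeff_sum sum_distrib_right)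
  also have "\<dots> = (\<Sum>k\<le>N. if k = n then int (N choose k) * (- 1) ^ k else 0)"
    unfolding eq coeff_sum by (intro sum.cong) (auto simp: c N_def)
  also have "\<dots> = (- 1) ^ n * int (N choose n)"
    by (subst sum.delta) (auto simp: N_def)
  finally show ?thesis by (simp add: N_def)
qed

section \<open>The two sides of the congruence as functions of \<open>a\<close>\<close>

definition truncated_hyp :: "'p::prime_card padic_int \<Rightarrow> 'p padic_int" where
  "truncated_hyp a = (\<Sum>k = 0..CARD('p) - 1.
    (pochhammer (- a) k * pochhammer (a + 1) k) div pochhammer 1 k * ((1 div 2) ^ k div fact k))"

definition gamma_side :: "'p::prime_card padic_int \<Rightarrow> 'p padic_int" where
  "gamma_side a = (- 1) ^ ((CARD('p) + 1) div 2)
    * padic_Gamma (1 div 2) * padic_Gamma (- a div 2) * padic_Gamma ((a + 1) div 2)"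

context
  fixes q h :: "'p::prime_card padic_int"
  assumes odd_card: "odd CARD('p)"
  defines "q \<equiv> of_nat CARD('p)" and "h \<equiv> 1 div 2"
begin

lemma two_mult_half: "2 * h = 1"
proof -
  have "CARD('p) > 2"
    using prime_ge_2_nat[OF prime_card[where ?'a = 'p]] odd_card by (cases "CARD('p) = 2") auto
  then have "(of_nat 2 :: 'p padic_int) dvd 1" by (intro padic_unit of_nat_not_dvd) auto
  then show ?thesis unfolding h_def by (intro mult_one_div) simp
qed

lemma div_two: "x div 2 = x * h"
  using two_mult_half by (rule div_eq_mult_inverse)

text \<open>Exact division becomes multiplication by constants, since \<open>fact k\<close> is a
  unit for \<open>k < p\<close>; the closure rules for \<open>affine_mod\<close> then apply.\<close>

lemma truncated_hyp_eq:
  "truncated_hyp a = (\<Sum>k = 0..CARD('p) - 1. pochhammer (- a) k * pochhammer (a + 1) k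
      * (1 div fact k) * (h ^ k * (1 div fact k)))"
  unfolding truncated_hyp_def
proof (rule sum.cong)
  fix k assume "k \<in> {0..CARD('p) - 1}"
  then have "k \<le> CARD('p) - 1" by simp
  then have "k < CARD('p)" using prime_gt_0_nat[OF prime_card[where ?'a = 'p]] by linarith
  then obtain v where "1 = fact k * (v :: 'p padic_int)" using padic_fact_unit by (blast elim: dvdE)
  then have "x div fact k = x * v" for x by (intro div_eq_mult_inverse) simp
  then show "(pochhammer (- a) k * pochhammer (a + 1) k) div pochhammer 1 k * ((1 div 2) ^ k div fact k)
      = pochhammer (- a) k * pochhammer (a + 1) k * (1 div fact k) * (h ^ k * (1 div fact k))"
    by (simp add: pochhammer_fact[symmetric] h_def)
qed simp

lemma gamma_side_eq:
  "gamma_side a = (- 1) ^ ((CARD('p) + 1) div 2) * padic_Gamma h * padic_Gamma (- a * h)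
    * padic_Gamma ((a + 1) * h)"
  unfolding gamma_side_def div_two by simp

text \<open>The substitution swaps \<open>- a\<close> and \<open>a + 1\<close>; the same swap gives
  the symmetry of \<open>gamma_side\<close>.\<close>

lemma truncated_hyp_reflect: "truncated_hyp (- 1 - a) = truncated_hyp a"
  by (simp add: truncated_hyp_def mult.commute add.commute)

lemma gamma_side_reflect: "gamma_side (- 1 - a) = gamma_side a"
  by (simp add: gamma_side_def mult_ac add.commute)

lemma affine_truncated_hyp: "affine_mod q (\<lambda>y. truncated_hyp (x + q * y))"
  unfolding truncated_hyp_eq pochhammer_prod
proof (intro affine_mod_sum affine_mod_mult affine_mod_prod affine_mod_const)
  fix i
  show "affine_mod q (\<lambda>y. - (x + q * y) + of_nat i)"
    using affine_mod_linear[of q "- x + of_nat i" "- 1"] by (simp add: algebra_simps)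
  show "affine_mod q (\<lambda>y. x + q * y + 1 + of_nat i)"
    using affine_mod_linear[of q "x + 1 + of_nat i" 1] by (simp add: algebra_simps)
qed

lemma affine_gamma_side: "affine_mod q (\<lambda>y. gamma_side (x + q * y))"
  unfolding gamma_side_eq
proof (intro affine_mod_mult affine_mod_const)
  show "affine_mod q (\<lambda>y. padic_Gamma (- (x + q * y) * h))"
    using affine_mod_compose_linear[OF affine_padic_Gamma[OF odd_card, of "- x * h"], of 0 "- h"]
    by (simp add: q_def algebra_simps)
  show "affine_mod q (\<lambda>y. padic_Gamma ((x + q * y + 1) * h))"
    using affine_mod_compose_linear[OF affine_padic_Gamma[OF odd_card, of "(x + 1) * h"], of 0 h]
    by (simp add: q_def algebra_simps)
qed

lemma four_power_unit: "(4 :: 'p padic_int) ^ n dvd 1"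
proof -
  have "(4 :: 'p padic_int) * h ^ 2 = (2 * h) ^ 2" by (simp add: power_mult_distrib)
  then have "(4 :: 'p padic_int) dvd 1" using two_mult_half by (metis dvd_triv_left power_one)
  then show ?thesis by (metis dvd_power_same power_one)
qed

text \<open>Here \<open>2 ^ n * pochhammer h n\<close> is the product of the first \<open>n\<close>
  odd numbers and \<open>2 ^ n * fact n\<close> that of the first \<open>n\<close> positive even
  numbers.\<close>

lemma fact_double_half: "4 ^ n * pochhammer h n * fact n = (fact (2 * n) :: 'p padic_int)"
proof (induction n)
  case (Suc n)
  have "4 ^ Suc n * pochhammer h (Suc n) * fact (Suc n)
      = (2 * (2 * h) + 4 * of_nat n) * of_nat (Suc n) * (4 ^ n * pochhammer h n * fact n)"
    by (simp add: pochhammer_rec' algebra_simps)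
  also have "\<dots> = (2 + 4 * of_nat n) * of_nat (Suc n) * fact (2 * n)"
    unfolding Suc two_mult_half by simp
  also have "\<dots> = fact (2 * Suc n)"
    by (simp add: algebra_simps)
  finally show ?case .
qed simp

text \<open>With denominators cleared this is an exact equality: multiplying the series by
  \<open>2 ^ (2 * n)\<close> produces the sum of \<open>central_Legendre_sum\<close>.\<close>

lemma truncated_hyp_even:
  assumes "2 * n < CARD('p)"
  shows "4 ^ n * fact n * fact n * truncated_hyp (of_nat (2 * n) :: 'p padic_int)
    = (- 1) ^ n * fact (2 * n)"
proof -
  define N where "N = 2 * n"
  let ?t = "\<lambda>k. pochhammer (- of_nat N) k * pochhammer (of_nat N + 1) k
      * (1 div fact k) * (h ^ k * (1 div fact k)) :: 'p padic_int"
  \<comment> \<open>The symbol \<open>pochhammer (- of_nat N) k\<close> vanishes for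
    \<open>k > N\<close>, and \<open>N < p\<close> keeps all remaining terms inside the
    truncation.\<close>
  have "truncated_hyp (of_nat N :: 'p padic_int) = (\<Sum>k\<le>N. ?t k)"
    unfolding truncated_hyp_eq
    by (rule sum.mono_neutral_right)
      (use assms in \<open>auto simp: N_def pochhammer_of_nat_eq_0_lemma simp del: of_nat_mult of_nat_numeral\<close>)
  then have "2 ^ N * truncated_hyp (of_nat N :: 'p padic_int) = (\<Sum>k\<le>N. 2 ^ N * ?t k)"
    by (simp add: sum_distrib_left)
  also have "\<dots> = (\<Sum>k\<le>N. of_int (int (N choose k) * int ((N + k) choose k) * (- 1) ^ k * 2 ^ (N - k)))"
  proof (rule sum.cong)
    fix k assume k: "k \<in> {..N}"
    then have f: "fact k * (1 div fact k) = (1 :: 'p padic_int)"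
      using assms by (intro mult_one_div padic_fact_unit) (auto simp: N_def)
    have "(2 :: 'p padic_int) ^ N * h ^ k = 2 ^ (N - k) * (2 * h) ^ k"
      using k by (simp add: power_mult_distrib flip: power_add mult.assoc)
    then have two: "(2 :: 'p padic_int) ^ N * h ^ k = 2 ^ (N - k)" by (simp add: two_mult_half)
    have "2 ^ N * ?t k = (2 ^ N * h ^ k) * (fact k * (1 div fact k)) * (fact k * (1 div fact k))
        * ((- 1) ^ k * of_nat (N choose k) * of_nat ((N + k) choose k))"
      using k by (simp add: pochhammer_neg_of_nat pochhammer_of_nat_plus_1 mult_ac)
    then show "2 ^ N * ?t k
        = of_int (int (N choose k) * int ((N + k) choose k) * (- 1) ^ k * 2 ^ (N - k))"
      unfolding f two by (simp add: mult_ac)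
  qed simp
  also have "\<dots> = of_int ((- 1) ^ n * int (N choose n))"
    using central_Legendre_sum[of n] unfolding N_def by (simp only: of_int_sum[symmetric])
  finally have "4 ^ n * truncated_hyp (of_nat N :: 'p padic_int) = (- 1) ^ n * of_nat (N choose n)"
    by (simp add: N_def power_mult)
  moreover have "fact n * fact n * of_nat (N choose n) = (fact N :: 'p padic_int)"
  proof -
    have "fact n * fact n * (N choose n) = (fact N :: nat)"
      using binomial_fact_lemma[of n N] by (simp add: N_def)
    then show ?thesis by (metis of_nat_fact of_nat_mult)
  qed
  moreover have "4 ^ n * fact n * fact n * truncated_hyp (of_nat N :: 'p padic_int)
      = fact n * fact n * (4 ^ n * truncated_hyp (of_nat N))"
    by (simp add: mult_ac)
  ultimately show ?thesis unfolding N_def[symmetric] by (simp add: mult_ac)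
qed

text \<open>Descending from the value \<open>1\<close> at \<open>0\<close>, the functional equation
  meets only the units \<open>- 1, ..., - n\<close>.\<close>

lemma padic_Gamma_neg_of_nat:
  assumes "n < CARD('p)"
  shows "fact n * padic_Gamma (- of_nat n :: 'p padic_int) = 1"
  using assms
proof (induction n)
  case 0
  show ?case by (simp add: padic_Gamma_0[OF odd_card])
next
  case (Suc n)
  have "\<not> of_nat CARD('p) dvd (- of_nat (Suc n) :: 'p padic_int)"
    unfolding dvd_minus_iff using Suc by (intro of_nat_not_dvd) auto
  from padic_Gamma_plus_1_unit[OF odd_card this]
  have "padic_Gamma (- of_nat n :: 'p padic_int) = of_nat (Suc n) * padic_Gamma (- of_nat (Suc n))"
    by simp
  then show ?case using Suc by (simp add: mult_ac)
qed

text \<open>Twice each factor \<open>h + i\<close> with \<open>i < n\<close> is the odd number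
  \<open>2 * i + 1 < p\<close>, so all factors are units.\<close>

lemma padic_Gamma_half_plus_of_nat:
  assumes "2 * n < CARD('p)"
  shows "padic_Gamma (h + of_nat n) = (- 1) ^ n * pochhammer h n * padic_Gamma h"
  using assms
proof (induction n)
  case (Suc n)
  have "\<not> of_nat CARD('p) dvd h + of_nat n"
  proof
    assume "of_nat CARD('p) dvd h + of_nat n"
    then have "of_nat CARD('p) dvd 2 * (h + of_nat n)" by (rule dvd_mult)
    also have "2 * (h + of_nat n) = of_nat (2 * n + 1)"
      using two_mult_half by (simp add: distrib_left)
    finally show False using Suc.prems of_nat_not_dvd[where ?'p = 'p, of "2 * n + 1"] by simp
  qed
  from padic_Gamma_plus_1_unit[OF odd_card this] show ?case
    using Suc by (simp add: pochhammer_rec' algebra_simps)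
qed simp

text \<open>Since \<open>1 - h = h\<close>, the square is a reflection product; it is evaluated at a
  natural number congruent to \<open>h\<close> modulo \<open>p ^ 2\<close>.\<close>

lemma padic_Gamma_half_square:
  "ring_cong (q ^ 2) (padic_Gamma h * padic_Gamma h) ((- 1) ^ ((CARD('p) + 1) div 2))"
proof -
  define r where "r = (CARD('p) + 1) div 2"
  \<comment> \<open>This is \<open>(p ^ 2 + 1) / 2\<close>, written as \<open>r\<close> plus a
    multiple of \<open>p\<close> so that periodicity reduces it to \<open>r\<close>.\<close>
  define m where "m = r + CARD('p) * ((CARD('p) - 1) div 2)"
  have "2 * m = CARD('p) ^ 2 + 1"
    using odd_card by (auto simp: m_def r_def power2_eq_square elim!: oddE)
  then have "of_nat (2 * m) = (of_nat (CARD('p) ^ 2 + 1) :: 'p padic_int)" by (rule arg_cong)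
  then have m2: "2 * of_nat m = q ^ 2 + 1" by (simp add: q_def)
  have "of_nat m - h = 2 * h * (of_nat m - h)" by (simp add: two_mult_half)
  also have "\<dots> = h * (2 * of_nat m - 2 * h)" by (simp add: algebra_simps)
  also have "\<dots> = q ^ 2 * h" unfolding m2 two_mult_half by simp
  finally have mh: "ring_cong (q ^ 2) h (of_nat m)"
    by (metis dvd_triv_left ring_cong_def ring_cong_sym)
  have "1 - h = h" using two_mult_half by (simp add: algebra_simps)
  then have "ring_cong (q ^ 2) (padic_Gamma h * padic_Gamma h) (padic_Gamma h * padic_Gamma (1 - h))"
    by (simp only: ring_cong_refl)
  also have "ring_cong (q ^ 2) \<dots> (padic_Gamma (of_nat m) * padic_Gamma (1 - of_nat m))"
    unfolding q_def
    by (intro ring_cong_mult padic_Gamma_cong odd_card ring_cong_diff ring_cong_refl mh[unfolded q_def])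
  also have "padic_Gamma (of_nat m) * padic_Gamma (1 - of_nat m :: 'p padic_int)
      = padic_Gamma (of_nat r) * padic_Gamma (1 - of_nat r)"
    unfolding m_def by (rule padic_Gamma_reflection_periodic[OF odd_card])
  also have "\<dots> = (- 1) ^ r"
  proof -
    have "1 \<le> r" "r \<le> CARD('p)" using odd_card unfolding r_def by presburger+
    then show ?thesis by (rule padic_Gamma_reflection_of_nat[OF odd_card])
  qed
  finally show ?thesis unfolding r_def .
qed

text \<open>A second factor \<open>padic_Gamma h\<close> arises from the argument
  \<open>h + n\<close>; the square of \<open>padic_Gamma h\<close> then cancels the sign in
  front.\<close>

lemma gamma_side_even:
  assumes "2 * n < CARD('p)"
  shows "ring_cong (q ^ 2) (4 ^ n * fact n * fact n * gamma_side (of_nat (2 * n)))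
    ((- 1) ^ n * fact (2 * n))"
proof -
  define s where "s = ((- 1) ^ ((CARD('p) + 1) div 2) :: 'p padic_int)"
  have args: "- of_nat (2 * n) * h = - of_nat n" "(of_nat (2 * n) + 1) * h = h + of_nat n"
    using two_mult_half by (simp_all add: algebra_simps)
  have "4 ^ n * fact n * fact n * gamma_side (of_nat (2 * n))
      = (fact n * padic_Gamma (- of_nat n)) * (4 ^ n * pochhammer h n * fact n) * (- 1) ^ n
        * (s * (padic_Gamma h * padic_Gamma h))"
    unfolding gamma_side_eq args padic_Gamma_half_plus_of_nat[OF assms] s_def by (simp add: mult_ac)
  also have "\<dots> = (- 1) ^ n * fact (2 * n) * (s * (padic_Gamma h * padic_Gamma h))"
    using assms by (simp add: padic_Gamma_neg_of_nat fact_double_half)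
  also have "ring_cong (q ^ 2) \<dots> ((- 1) ^ n * fact (2 * n) * (s * s))"
    unfolding s_def by (intro ring_cong_mult ring_cong_refl padic_Gamma_half_square)
  also have "s * s = 1" by (simp add: s_def flip: power_add)
  finally show ?thesis by simp
qed

text \<open>The common factor \<open>4 ^ n * fact n * fact n\<close> is a unit because
  \<open>n < p\<close>, so it can be cancelled.\<close>

lemma truncated_hyp_cong_gamma_side_even:
  assumes "even N" "N < CARD('p)"
  shows "q ^ 2 dvd truncated_hyp (of_nat N) - gamma_side (of_nat N)"
proof -
  obtain n where N: "N = 2 * n" using assms(1) by (rule evenE)
  have n: "2 * n < CARD('p)" using assms N by simp
  have "(fact n :: 'p padic_int) dvd 1" using n by (intro padic_fact_unit) simp
  then have "4 ^ n * fact n * fact n dvd (1 * 1 * 1 :: 'p padic_int)"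
    by (intro mult_dvd_mono four_power_unit)
  moreover have "ring_cong (q ^ 2) (4 ^ n * fact n * fact n * truncated_hyp (of_nat N))
      (4 ^ n * fact n * fact n * gamma_side (of_nat N))"
    using ring_cong_sym[OF gamma_side_even[OF n]] unfolding N truncated_hyp_even[OF n] .
  ultimately show ?thesis
    using ring_cong_cancel unfolding ring_cong_def by (metis mult_1_left)
qed

lemma truncated_hyp_cong_gamma_side:
  assumes "even (least_residue a)"
  shows "q ^ 2 dvd truncated_hyp a - gamma_side a"
proof -
  define r where "r = least_residue a"
  have P0: "CARD('p) > 0" using prime_gt_0_nat[OF prime_card[where ?'a = 'p]] .
  have dvd: "of_nat CARD('p) dvd a - of_nat (nat_residue a 1)"
    using nat_residue_cong[of 1 a] by (simp add: ring_cong_def)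
  \<comment> \<open>The minimum in \<open>least_residue\<close> carries no explicit upper bound;
    comparison with the canonical residue gives \<open>r < p\<close>.\<close>
  have "r \<le> nat_residue a 1"
    unfolding r_def least_residue_def by (rule Least_le) (rule dvd)
  also have "nat_residue a 1 < CARD('p)"
    using residues_of_mod[of a 1] pos_mod_bound[of "int CARD('p)" "residues_of a 1"] P0
    by (simp add: nat_residue_def nat_less_iff residues_of_nonneg)
  finally have r: "r < CARD('p)" .
  have "q dvd a - of_nat r"
    unfolding r_def least_residue_def q_def by (rule LeastI) (rule dvd)
  then obtain y where "a - of_nat r = q * y" by (rule dvdE)
  then have a: "a = of_nat r + q * y" by (simp add: algebra_simps)
  let ?f = "\<lambda>y. truncated_hyp (of_nat r + q * y) - gamma_side (of_nat r + q * y)"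
  have "affine_mod q ?f"
    by (intro affine_mod_diff affine_truncated_hyp affine_gamma_side)
  moreover have "q ^ 2 dvd ?f 0"
    using truncated_hyp_cong_gamma_side_even[of r] assms r by (simp add: r_def)
  moreover have "q ^ 2 dvd ?f (- 1)"
  proof -
    \<comment> \<open>The point \<open>r - p\<close> is the reflection of \<open>p - 1 - r\<close>,
      which is even since \<open>p - 1\<close> and \<open>r\<close> are.\<close>
    have "of_nat r + q * (- 1) = - 1 - of_nat (CARD('p) - 1 - r)"
      using r by (simp add: q_def of_nat_diff)
    moreover have "even (CARD('p) - 1 - r)" using odd_card assms r by (simp add: r_def)
    ultimately show ?thesis
      using truncated_hyp_cong_gamma_side_even[of "CARD('p) - 1 - r"] P0
      by (simp only: truncated_hyp_reflect gamma_side_reflect)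
  qed
  ultimately show ?thesis unfolding a by (rule affine_mod_eq_zero)
qed

end

theorem theorem1:
  fixes p :: nat and a :: "'p::prime_card padic_int"
  assumes "p = CARD('p)" and "p \<ge> 5"
    and "even (least_residue a)"
  shows "of_nat p ^ 2 dvd
    (\<Sum>k = 0..p - 1. (pochhammer (- a) k * pochhammer (a + 1) k) div pochhammer 1 k
        * ((1 div 2) ^ k div fact k))
    - (- 1) ^ ((p + 1) div 2)
        * padic_Gamma (1 div 2) * padic_Gamma (- a div 2) * padic_Gamma ((a + 1) div 2)"
proof -
  have "odd CARD('p)"
    using prime_odd_nat[OF prime_card[where ?'a = 'p]] assms(1,2) by simp
  from truncated_hyp_cong_gamma_side[OF this assms(3)] show ?thesis
    unfolding truncated_hyp_def gamma_side_def assms(1) .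
qed

end
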